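(* Let $T$ be an $\mathcal{O}$-operator on a Hom-associative algebra $(A,\mu,\alpha)$ with respect to a bimodule $(M,l,r,\phi)$, and let $T_t=\sum_{i\ge0}t^iT_i$ and $\overline{T}_t=\sum_{i\ge0}t^i\overline{T}_i$ be two equivalent formal one-parameter deformations of $T$. Then their infinitesimals $T_1$ and $\overline{T}_1$ are cohomologous, i.e. they define the same class in $H^1_\alpha(M,A)$.
   Context: All vector spaces are over a field $\mathbb{K}$. A Hom-associative algebra $(A,\mu,\alpha)$ (always multiplicative) is a vector space $A$ with a bilinear map $\mu$, written $\mu(a,b)=a\cdot b$, and a linear map $\alpha:A\to A$ such that $\alpha(a\cdot b)=\alpha(a)\cdot\alpha(b)$ and $\alpha(a)\cdot(b\cdot c)=(a\cdot b)\cdot\alpha(c)$ for all $a,b,c\in A$. A bimodule $(M,l,r,\phi)$ over $(A,\mu,\alpha)$ is a vector space $M$ with linear maps $\phi:M\to M$, $l:A\otimes M\to M$, $r:M\otimes A\to M$ such that for all $x,y\in A$, $v\in M$: $\phi l(x,v)=l(\alpha(x),\phi(v))$, $\phi r(v,x)=r(\phi(v),\alpha(x))$, $l(x\cdot y,\phi(v))=l(\alpha(x),l(y,v))$, $r(\phi(v),x\cdot y)=r(r(v,x),\alpha(y))$, $l(\alpha(x),r(v,y))=r(l(x,v),\alpha(y))$. An $\mathcal{O}$-operator on $A$ with respect to $M$ is a linear map $T:M\to A$ with $T\phi=\alpha T$ and $T(u)\cdot T(v)=T(l(T(u),v)+r(u,T(v)))$ for all $u,v\in M$. $C^1_{\phi,\alpha}(M,A)$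 is the space of linear maps $f:M\to A$ with $\alpha f=f\phi$. Extending $\mu,\alpha,l,r,\phi$ $\mathbb{K}[[t]]$-linearly, $A[[t]]$ is a Hom-associative algebra over $\mathbb{K}[[t]]$ and $M[[t]]$ a bimodule over it. A formal one-parameter deformation of $T$ is $T_t=\sum_{i\ge0}t^iT_i$ with $T_0=T$, $T_i\in C^1_{\phi,\alpha}(M,A)$, such that the $\mathbb{K}[[t]]$-linear map $T_t:M[[t]]\to A[[t]]$ is an $\mathcal{O}$-operator on $A[[t]]$ with respect to $M[[t]]$. Its infinitesimal is $T_1$. For $x\in A$ write $L_x(y)=x\cdot y$, $R_x(y)=y\cdot x$, $l_x(u)=l(x,u)$, $r_x(u)=r(u,x)$. Two formal deformations $T_t,\overline{T}_t$ of $T$ are equivalent if there exist $x\in A$ with $\alpha(x)=x$ and linear maps $f_i:A\to A$, $g_i:M\to M$ ($i\ge2$) such that $f_t=\mathrm{id}_A+t(L_x-R_x)+\sum_{i\ge2}t^if_i$ and $g_t=\mathrm{id}_M+t(l_x-r_x)+\sum_{i\ge2}t^ig_i$ satisfy, for all $y,z\in A$, $u\in M$: $f_tT_t=\overline{T}_tg_t$, $f_t(y\cdot z)=f_t(y)\cdot f_t(z)$, $g_t(l(y,u))=l(f_t(y),g_t(u))$, $g_t(r(u,y))=r(g_t(u),f_t(y))$, $f_t\alpha=\alpha f_t$, $g_t\phi=\phi g_t$. $H^1_\alpha(M,A)=Z^1_\alpha(M,A)/B^1_\alpha(M,A)$, where $Z^1_\alpha(M,A)$ is the space of $f\in C^1_{\phi,\alpha}(M,A)$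 with $T(u)\cdot f(v)+f(u)\cdot T(v)-T(r(u,f(v))+l(f(u),v))-f(r(u,T(v))+l(T(u),v))=0$ for all $u,v\in M$, and $B^1_\alpha(M,A)=\{d_H(a):a\in A,\ \alpha(a)=a\}$ with $d_H(a)(u)=T(u)\cdot a-T(r(u,a))-a\cdot T(u)+T(l(a,u))$. *)

theory Defs
  imports "HOL-Computational_Algebra.Formal_Power_Series"
begin

section \<open>Hom-associative algebras, bimodules and O-operators over a commutative ring\<close>

text \<open>
  Everything is set up over a commutative ring, so that the same definitions apply over a field
  \<open>K\<close> (where \<^const>\<open>module\<close> and \<^const>\<open>module_hom\<close> are vector spaces and linear maps) and over
  the ring of formal power series \<open>K[[t]]\<close>. The underlying additive groups are whole types.
\<close>

record ('k, 'a) hom_alg =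
  smult :: "'k \<Rightarrow> 'a \<Rightarrow> 'a"
  mul :: "'a \<Rightarrow> 'a \<Rightarrow> 'a"
  twist :: "'a \<Rightarrow> 'a"

record ('k, 'a, 'm) hom_bimod =
  msmult :: "'k \<Rightarrow> 'm \<Rightarrow> 'm"
  lact :: "'a \<Rightarrow> 'm \<Rightarrow> 'm"
  ract :: "'m \<Rightarrow> 'a \<Rightarrow> 'm"
  mtwist :: "'m \<Rightarrow> 'm"

definition bilinear_map ::
  "('k::comm_ring_1 \<Rightarrow> 'a::ab_group_add \<Rightarrow> 'a) \<Rightarrow> ('k \<Rightarrow> 'b::ab_group_add \<Rightarrow> 'b) \<Rightarrow>
   ('k \<Rightarrow> 'c::ab_group_add \<Rightarrow> 'c) \<Rightarrow> ('a \<Rightarrow> 'b \<Rightarrow> 'c) \<Rightarrow> bool" where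
  "bilinear_map s1 s2 s3 B \<longleftrightarrow>
     (\<forall>x. module_hom s2 s3 (\<lambda>y. B x y)) \<and> (\<forall>y. module_hom s1 s3 (\<lambda>x. B x y))"

definition hom_assoc_algebra :: "('k::comm_ring_1, 'a::ab_group_add) hom_alg \<Rightarrow> bool" where
  "hom_assoc_algebra A \<longleftrightarrow>
     module (smult A) \<and>
     bilinear_map (smult A) (smult A) (smult A) (mul A) \<and>
     module_hom (smult A) (smult A) (twist A) \<and>
     (\<forall>a b. twist A (mul A a b) = mul A (twist A a) (twist A b)) \<and>
     (\<forall>a b c. mul A (twist A a) (mul A b c) = mul A (mul A a b) (twist A c))"

definition hom_bimodule ::
  "('k::comm_ring_1, 'a::ab_group_add) hom_alg \<Rightarrow> ('k, 'a, 'm::ab_group_add) hom_bimod \<Rightarrow> bool" where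
  "hom_bimodule A M \<longleftrightarrow>
     module (msmult M) \<and>
     module_hom (msmult M) (msmult M) (mtwist M) \<and>
     bilinear_map (smult A) (msmult M) (msmult M) (lact M) \<and>
     bilinear_map (msmult M) (smult A) (msmult M) (ract M) \<and>
     (\<forall>x v. mtwist M (lact M x v) = lact M (twist A x) (mtwist M v)) \<and>
     (\<forall>x v. mtwist M (ract M v x) = ract M (mtwist M v) (twist A x)) \<and>
     (\<forall>x y v. lact M (mul A x y) (mtwist M v) = lact M (twist A x) (lact M y v)) \<and>
     (\<forall>x y v. ract M (mtwist M v) (mul A x y) = ract M (ract M v x) (twist A y)) \<and>
     (\<forall>x y v. lact M (twist A x) (ract M v y) = ract M (lact M x v) (twist A y))"

definition C1 ::
  "('k::comm_ring_1, 'a::ab_group_add) hom_alg \<Rightarrow> ('k, 'a, 'm::ab_group_add) hom_bimod \<Rightarrow>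
   ('m \<Rightarrow> 'a) set" where
  "C1 A M = {f. module_hom (msmult M) (smult A) f \<and> (\<forall>u. twist A (f u) = f (mtwist M u))}"

definition O_operator ::
  "('k::comm_ring_1, 'a::ab_group_add) hom_alg \<Rightarrow> ('k, 'a, 'm::ab_group_add) hom_bimod \<Rightarrow>
   ('m \<Rightarrow> 'a) \<Rightarrow> bool" where
  "O_operator A M T \<longleftrightarrow>
     module_hom (msmult M) (smult A) T \<and>
     (\<forall>u. T (mtwist M u) = twist A (T u)) \<and>
     (\<forall>u v. mul A (T u) (T v) = T (lact M (T u) v + ract M u (T v)))"


section \<open>Extension to formal power series\<close>

text \<open>
  For an abelian group \<open>V\<close>, the group \<open>V[[t]]\<close> is \<open>V fps\<close>; the library's type of formal power
  series does not require a multiplication on the coefficients. A bilinear map (in particular a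
  scalar multiplication) extends by the Cauchy product, a linear map coefficientwise, and a
  sequence \<open>F\<close> of linear maps gives \<open>\<Sum>i. t^i F\<^sub>i\<close> on \<open>V[[t]]\<close>.
\<close>

definition ps_bilinear :: "('a \<Rightarrow> 'b \<Rightarrow> 'c::comm_monoid_add) \<Rightarrow> 'a fps \<Rightarrow> 'b fps \<Rightarrow> 'c fps" where
  "ps_bilinear B x y = Abs_fps (\<lambda>n. \<Sum>i=0..n. B (fps_nth x i) (fps_nth y (n - i)))"

definition ps_linear :: "('a \<Rightarrow> 'b) \<Rightarrow> 'a fps \<Rightarrow> 'b fps" where
  "ps_linear f x = Abs_fps (\<lambda>n. f (fps_nth x n))"

definition ps_series :: "(nat \<Rightarrow> 'a \<Rightarrow> 'b::comm_monoid_add) \<Rightarrow> 'a fps \<Rightarrow> 'b fps" where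
  "ps_series F x = Abs_fps (\<lambda>n. \<Sum>i=0..n. F i (fps_nth x (n - i)))"

definition ps_alg :: "('k::comm_ring_1, 'a::ab_group_add) hom_alg \<Rightarrow> ('k fps, 'a fps) hom_alg" where
  "ps_alg A = \<lparr> smult = ps_bilinear (smult A), mul = ps_bilinear (mul A),
                twist = ps_linear (twist A) \<rparr>"

definition ps_bimod ::
  "('k::comm_ring_1, 'a::ab_group_add, 'm::ab_group_add) hom_bimod \<Rightarrow>
   ('k fps, 'a fps, 'm fps) hom_bimod" where
  "ps_bimod M = \<lparr> msmult = ps_bilinear (msmult M), lact = ps_bilinear (lact M),
                  ract = ps_bilinear (ract M), mtwist = ps_linear (mtwist M) \<rparr>"


section \<open>Formal deformations and their equivalence\<close>

definition formal_deformation ::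
  "('k::comm_ring_1, 'a::ab_group_add) hom_alg \<Rightarrow> ('k, 'a, 'm::ab_group_add) hom_bimod \<Rightarrow>
   ('m \<Rightarrow> 'a) \<Rightarrow> (nat \<Rightarrow> 'm \<Rightarrow> 'a) \<Rightarrow> bool" where
  "formal_deformation A M T Tt \<longleftrightarrow>
     Tt 0 = T \<and> (\<forall>i. Tt i \<in> C1 A M) \<and> O_operator (ps_alg A) (ps_bimod M) (ps_series Tt)"

definition infinitesimal :: "(nat \<Rightarrow> 'm \<Rightarrow> 'a) \<Rightarrow> 'm \<Rightarrow> 'a" where
  "infinitesimal Tt = Tt 1"

text \<open>
  An element \<open>y\<close> of \<open>A\<close> (or \<open>M\<close>) is regarded as the constant series \<open>fps_const y\<close>. The
  multiplicativity conditions are imposed on elements of \<open>A\<close> and \<open>M\<close>, the commutation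
  conditions are equalities of maps on \<open>A[[t]]\<close> and \<open>M[[t]]\<close>.
\<close>

definition equivalent_deformations ::
  "('k::comm_ring_1, 'a::ab_group_add) hom_alg \<Rightarrow> ('k, 'a, 'm::ab_group_add) hom_bimod \<Rightarrow>
   (nat \<Rightarrow> 'm \<Rightarrow> 'a) \<Rightarrow> (nat \<Rightarrow> 'm \<Rightarrow> 'a) \<Rightarrow> bool" where
  "equivalent_deformations A M Tt Tt' \<longleftrightarrow>
     (\<exists>x f g. twist A x = x \<and>
        f 0 = id \<and> f 1 = (\<lambda>y. mul A x y - mul A y x) \<and>
        (\<forall>i\<ge>2. module_hom (smult A) (smult A) (f i)) \<and>
        g 0 = id \<and> g 1 = (\<lambda>u. lact M x u - ract M u x) \<and>
        (\<forall>i\<ge>2. module_hom (msmult M) (msmult M) (g i)) \<and>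
        ps_series f \<circ> ps_series Tt = ps_series Tt' \<circ> ps_series g \<and>
        (\<forall>y z. ps_series f (fps_const (mul A y z)) =
           mul (ps_alg A) (ps_series f (fps_const y)) (ps_series f (fps_const z))) \<and>
        (\<forall>y u. ps_series g (fps_const (lact M y u)) =
           lact (ps_bimod M) (ps_series f (fps_const y)) (ps_series g (fps_const u))) \<and>
        (\<forall>y u. ps_series g (fps_const (ract M u y)) =
           ract (ps_bimod M) (ps_series g (fps_const u)) (ps_series f (fps_const y))) \<and>
        ps_series f \<circ> twist (ps_alg A) = twist (ps_alg A) \<circ> ps_series f \<and>
        ps_series g \<circ> mtwist (ps_bimod M) = mtwist (ps_bimod M) \<circ> ps_series g)"


section \<open>First cohomology\<close>

definition Z1 ::
  "('k::comm_ring_1, 'a::ab_group_add) hom_alg \<Rightarrow> ('k, 'a, 'm::ab_group_add) hom_bimod \<Rightarrow>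
   ('m \<Rightarrow> 'a) \<Rightarrow> ('m \<Rightarrow> 'a) set" where
  "Z1 A M T = {f \<in> C1 A M. \<forall>u v.
     mul A (T u) (f v) + mul A (f u) (T v)
       - T (ract M u (f v) + lact M (f u) v)
       - f (ract M u (T v) + lact M (T u) v) = 0}"

definition dH ::
  "('k::comm_ring_1, 'a::ab_group_add) hom_alg \<Rightarrow> ('k, 'a, 'm::ab_group_add) hom_bimod \<Rightarrow>
   ('m \<Rightarrow> 'a) \<Rightarrow> 'a \<Rightarrow> 'm \<Rightarrow> 'a" where
  "dH A M T a u = mul A (T u) a - T (ract M u a) - mul A a (T u) + T (lact M a u)"

definition B1 ::
  "('k::comm_ring_1, 'a::ab_group_add) hom_alg \<Rightarrow> ('k, 'a, 'm::ab_group_add) hom_bimod \<Rightarrow>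
   ('m \<Rightarrow> 'a) \<Rightarrow> ('m \<Rightarrow> 'a) set" where
  "B1 A M T = {dH A M T a | a. twist A a = a}"

text \<open>
  The quotient \<open>Z1 / B1\<close> is the set of classes of cocycles modulo the relation that the difference
  is in \<open>B1\<close>. This is an equivalence relation on \<open>Z1\<close> (\<open>equiv_cohomologous\<close> below) without using
  \<open>B1 \<subseteq> Z1\<close>, an inclusion that the Hom-associativity identity does not yield directly because its
  left factor is twisted; the quotient is in any case \<open>Z1 / (B1 \<inter> Z1)\<close>.
\<close>

definition cohomologous ::
  "('k::comm_ring_1, 'a::ab_group_add) hom_alg \<Rightarrow> ('k, 'a, 'm::ab_group_add) hom_bimod \<Rightarrow>
   ('m \<Rightarrow> 'a) \<Rightarrow> (('m \<Rightarrow> 'a) \<times> ('m \<Rightarrow> 'a)) set" where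
  "cohomologous A M T = {(f, g). f \<in> Z1 A M T \<and> g \<in> Z1 A M T \<and> (\<lambda>u. f u - g u) \<in> B1 A M T}"

definition H1 ::
  "('k::comm_ring_1, 'a::ab_group_add) hom_alg \<Rightarrow> ('k, 'a, 'm::ab_group_add) hom_bimod \<Rightarrow>
   ('m \<Rightarrow> 'a) \<Rightarrow> ('m \<Rightarrow> 'a) set set" where
  "H1 A M T = Z1 A M T // cohomologous A M T"

definition cohomology_class ::
  "('k::comm_ring_1, 'a::ab_group_add) hom_alg \<Rightarrow> ('k, 'a, 'm::ab_group_add) hom_bimod \<Rightarrow>
   ('m \<Rightarrow> 'a) \<Rightarrow> ('m \<Rightarrow> 'a) \<Rightarrow> ('m \<Rightarrow> 'a) set" where
  "cohomology_class A M T f = cohomologous A M T `` {f}"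


section \<open>Well-definedness\<close>

lemma bilinear_map_additive:
  assumes "bilinear_map s1 s2 s3 B"
  shows "Modules.additive (B x)" "Modules.additive (\<lambda>x. B x y)"
  using assms by (auto simp: bilinear_map_def module_hom_iff additive_def)

lemma ps_bilinear_assoc:
  assumes P: "\<And>x. Modules.additive (P x)" and R: "\<And>y. Modules.additive (\<lambda>x. R x y)"
    and eq: "\<And>x y z. P (f x) (Q y z) = R (S x y) (h z)"
  shows "ps_bilinear P (ps_linear f x) (ps_bilinear Q y z) =
         ps_bilinear R (ps_bilinear S x y) (ps_linear h z)"
proof (rule fps_ext)
  fix n
  let ?F = "\<lambda>i j k. P (f (fps_nth x i)) (Q (fps_nth y j) (fps_nth z k))"
  have "fps_nth (ps_bilinear P (ps_linear f x) (ps_bilinear Q y z)) n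
      = (\<Sum>j=0..n. \<Sum>i=0..n-j. ?F j i (n - j - i))"
    by (simp add: ps_bilinear_def ps_linear_def additive.sum[OF P])
  also have "\<dots> = (\<Sum>j=0..n. \<Sum>i=0..j. ?F i (j - i) (n - j))"
    by (rule fps_mult_assoc_lemma[symmetric])
  also have "\<dots> = fps_nth (ps_bilinear R (ps_bilinear S x y) (ps_linear h z)) n"
    by (simp add: ps_bilinear_def ps_linear_def additive.sum[OF R] eq)
  finally show "fps_nth (ps_bilinear P (ps_linear f x) (ps_bilinear Q y z)) n =
    fps_nth (ps_bilinear R (ps_bilinear S x y) (ps_linear h z)) n" .
qed

lemma ps_linear_id: "ps_linear (\<lambda>x. x) = (\<lambda>x. x)"
  by (auto simp: fun_eq_iff fps_eq_iff ps_linear_def)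

lemma ps_bilinear_flip: "ps_bilinear B x y = ps_bilinear (\<lambda>y x. B x y) y x"
  by (simp add: ps_bilinear_def fps_mult_commute_lemma[of "\<lambda>i j. B (fps_nth x i) (fps_nth y j)"])

lemma ps_bilinear_add:
  assumes "bilinear_map s1 s2 s3 B"
  shows "ps_bilinear B (x + x') y = ps_bilinear B x y + ps_bilinear B x' y"
    and "ps_bilinear B x (y + y') = ps_bilinear B x y + ps_bilinear B x y'"
  using bilinear_map_additive[OF assms]
  by (auto simp: ps_bilinear_def fps_eq_iff sum.distrib additive.add additive_def)

lemma module_additive:
  assumes "module s"
  shows "Modules.additive (s x)" "Modules.additive (\<lambda>x. s x y)"
  using assms by (auto simp: module_def additive_def)

lemma ps_bilinear_times: "ps_bilinear (*) = ((*) :: 'k::comm_ring_1 fps \<Rightarrow> _)"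
  by (auto simp: fun_eq_iff ps_bilinear_def fps_eq_iff fps_mult_nth)

lemma ps_module:
  fixes s :: "'k::comm_ring_1 \<Rightarrow> 'a::ab_group_add \<Rightarrow> 'a"
  assumes "module s"
  shows "module (ps_bilinear s)"
proof
  interpret module s by fact
  fix c d :: "'k fps" and x y :: "'a fps"
  show "ps_bilinear s c (x + y) = ps_bilinear s c x + ps_bilinear s c y"
    by (simp add: ps_bilinear_def fps_eq_iff scale_right_distrib sum.distrib)
  show "ps_bilinear s (c + d) x = ps_bilinear s c x + ps_bilinear s d x"
    by (simp add: ps_bilinear_def fps_eq_iff scale_left_distrib sum.distrib)
  show "ps_bilinear s c (ps_bilinear s d x) = ps_bilinear s (c * d) x"
    using ps_bilinear_assoc[of s s "\<lambda>x. x" s "(*)" "\<lambda>x. x" c d x] module_additive[OF assms]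
    by (simp add: ps_linear_id ps_bilinear_times)
  show "ps_bilinear s 1 x = x"
    by (simp add: ps_bilinear_def fps_eq_iff sum.atLeast_Suc_atMost)
qed

lemma ps_linear_module_hom:
  assumes "module_hom s1 s2 f"
  shows "module_hom (ps_bilinear s1) (ps_bilinear s2) (ps_linear f)"
proof -
  interpret module_hom s1 s2 f by fact
  show ?thesis
    unfolding module_hom_iff using m1.module_axioms[THEN ps_module] m2.module_axioms[THEN ps_module]
    by (auto simp: ps_linear_def ps_bilinear_def fps_eq_iff add scale sum)
qed

lemma ps_bilinear_map:
  assumes "bilinear_map s1 s2 s3 B"
  shows "bilinear_map (ps_bilinear s1) (ps_bilinear s2) (ps_bilinear s3) (ps_bilinear B)"
proof -
  note ad = bilinear_map_additive[OF assms]
  have m: "module s1" "module s2" "module s3"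
    using assms by (auto simp: bilinear_map_def module_hom_iff)
  have sc1: "B (s1 c x) y = s3 c (B x y)" and sc2: "B x (s2 c y) = s3 c (B x y)" for c x y
    using assms by (auto simp: bilinear_map_def module_hom_iff)
  have l: "ps_bilinear B (ps_bilinear s1 c x) y = ps_bilinear s3 c (ps_bilinear B x y)" for c x y
    using ps_bilinear_assoc[of s3 B "\<lambda>x. x" B s1 "\<lambda>x. x" c x y] ad module_additive[OF m(3)] sc1
    by (simp add: ps_linear_id)
  have r: "ps_bilinear B x (ps_bilinear s2 c y) = ps_bilinear s3 c (ps_bilinear B x y)" for c x y
    using ps_bilinear_assoc[of s3 "\<lambda>y x. B x y" "\<lambda>x. x" "\<lambda>y x. B x y" s2 "\<lambda>x. x" c y x]
      ad module_additive[OF m(3)] sc2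
    by (simp add: ps_linear_id ps_bilinear_flip[of B])
  show ?thesis
    unfolding bilinear_map_def module_hom_iff
    using m[THEN ps_module] l r ps_bilinear_add[OF assms] by auto
qed

lemma ps_series_module_hom:
  assumes "\<And>i. module_hom s1 s2 (F i)"
  shows "module_hom (ps_bilinear s1) (ps_bilinear s2) (ps_series F)"
proof -
  have m: "module s1" "module s2"
    using assms[of 0] by (auto simp: module_hom_iff)
  have ad: "Modules.additive (F i)" for i
    using assms by (auto simp: module_hom_iff additive_def)
  have eq: "ps_series F x = ps_bilinear (\<lambda>x G. G x) x (Abs_fps F)" for x
    unfolding ps_series_def ps_bilinear_def
    using fps_mult_commute_lemma[of "\<lambda>i j. F i (fps_nth x j)"] by simp
  have "ps_series F (x + y) = ps_series F x + ps_series F y" for x y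
    by (simp add: ps_series_def fps_eq_iff additive.add[OF ad] sum.distrib)
  moreover have "ps_series F (ps_bilinear s1 c x) = ps_bilinear s2 c (ps_series F x)" for c x
  proof (rule fps_ext)
    fix n
    have "fps_nth (ps_bilinear s2 c (ps_series F x)) n =
      (\<Sum>j=0..n. \<Sum>i=0..n-j. s2 (fps_nth c j) (F (n - j - i) (fps_nth x i)))"
      by (simp add: eq) (simp add: ps_bilinear_def additive.sum[OF module_additive(1)[OF m(2)]])
    also have "\<dots> = (\<Sum>j=0..n. \<Sum>i=0..j. s2 (fps_nth c i) (F (n - j) (fps_nth x (j - i))))"
      by (rule fps_mult_assoc_lemma[symmetric])
    also have "\<dots> = fps_nth (ps_series F (ps_bilinear s1 c x)) n"
      using assms by (simp add: eq) (simp add: ps_bilinear_def additive.sum[OF ad] module_hom_iff)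
    finally show "fps_nth (ps_series F (ps_bilinear s1 c x)) n =
      fps_nth (ps_bilinear s2 c (ps_series F x)) n" ..
  qed
  ultimately show ?thesis
    unfolding module_hom_iff using m[THEN ps_module] by auto
qed

lemma ps_linear_bilinear:
  assumes "Modules.additive f" "\<And>x y. f (B x y) = C (g x) (h y)"
  shows "ps_linear f (ps_bilinear B x y) = ps_bilinear C (ps_linear g x) (ps_linear h y)"
  by (simp add: ps_linear_def ps_bilinear_def fps_eq_iff additive.sum[OF assms(1)] assms(2))

lemma hom_assoc_algebra_ps:
  assumes "hom_assoc_algebra A"
  shows "hom_assoc_algebra (ps_alg A)"
proof -
  note a = assms[unfolded hom_assoc_algebra_def]
  have bil: "bilinear_map (smult A) (smult A) (smult A) (mul A)"
    and tw: "module_hom (smult A) (smult A) (twist A)"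
    using a by auto
  note ad = bilinear_map_additive[OF bil]
  have at: "Modules.additive (twist A)"
    using tw by (auto simp: module_hom_iff additive_def)
  show ?thesis
    unfolding hom_assoc_algebra_def ps_alg_def hom_alg.simps
    using a
    by (auto intro!: ps_module ps_bilinear_map ps_linear_module_hom
        ps_linear_bilinear ps_bilinear_assoc ad at)
qed

lemma hom_bimodule_ps:
  assumes "hom_assoc_algebra A" "hom_bimodule A M"
  shows "hom_bimodule (ps_alg A) (ps_bimod M)"
proof -
  note a = assms(2)[unfolded hom_bimodule_def]
  have bl: "bilinear_map (smult A) (msmult M) (msmult M) (lact M)"
    and br: "bilinear_map (msmult M) (smult A) (msmult M) (ract M)"
    and tw: "module_hom (msmult M) (msmult M) (mtwist M)"
    using a by auto
  note ad = bilinear_map_additive[OF bl] bilinear_map_additive[OF br]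
  have at: "Modules.additive (mtwist M)"
    using tw by (auto simp: module_hom_iff additive_def)
  have "ps_bilinear (lact M) (ps_bilinear (mul A) x y) (ps_linear (mtwist M) v) =
        ps_bilinear (lact M) (ps_linear (twist A) x) (ps_bilinear (lact M) y v)" for x y v
    by (rule ps_bilinear_assoc[symmetric]) (use a ad in auto)
  moreover have "ps_bilinear (ract M) (ps_linear (mtwist M) v) (ps_bilinear (mul A) x y) =
        ps_bilinear (ract M) (ps_bilinear (ract M) v x) (ps_linear (twist A) y)" for x y v
    by (rule ps_bilinear_assoc) (use a ad in auto)
  moreover have "ps_bilinear (lact M) (ps_linear (twist A) x) (ps_bilinear (ract M) v y) =
        ps_bilinear (ract M) (ps_bilinear (lact M) x v) (ps_linear (twist A) y)" for x y v
    by (rule ps_bilinear_assoc) (use a ad in auto)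
  moreover have
    "ps_linear (mtwist M) (ps_bilinear (lact M) x v) =
       ps_bilinear (lact M) (ps_linear (twist A) x) (ps_linear (mtwist M) v)"
    "ps_linear (mtwist M) (ps_bilinear (ract M) v x) =
       ps_bilinear (ract M) (ps_linear (mtwist M) v) (ps_linear (twist A) x)" for x v
    by (rule ps_linear_bilinear; use a at in auto)+
  ultimately show ?thesis
    unfolding hom_bimodule_def ps_alg_def ps_bimod_def hom_alg.simps hom_bimod.simps
    using a
    by (auto intro!: ps_module ps_bilinear_map ps_linear_module_hom)
qed

lemma additive_dH:
  assumes A: "hom_assoc_algebra A" and M: "hom_bimodule A M" and T: "O_operator A M T"
  shows "Modules.additive (\<lambda>a. dH A M T a u)"
proof -
  have "bilinear_map (smult A) (smult A) (smult A) (mul A)"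
    and "bilinear_map (smult A) (msmult M) (msmult M) (lact M)"
    and "bilinear_map (msmult M) (smult A) (msmult M) (ract M)"
    using A M by (auto simp: hom_assoc_algebra_def hom_bimodule_def)
  note ad = this[THEN bilinear_map_additive(1)] this[THEN bilinear_map_additive(2)]
  have aT: "Modules.additive T"
    using T by (auto simp: O_operator_def module_hom_iff additive_def)
  show ?thesis
    by (simp add: dH_def additive_def additive.add[OF ad(1)] additive.add[OF ad(3)]
        additive.add[OF ad(4)] additive.add[OF ad(5)] additive.add[OF aT])
qed

lemma equiv_cohomologous:
  assumes A: "hom_assoc_algebra A" and M: "hom_bimodule A M" and T: "O_operator A M T"
  shows "equiv (Z1 A M T) (cohomologous A M T)"
proof -
  have tw: "Modules.additive (twist A)"
    using A by (auto simp: hom_assoc_algebra_def module_hom_iff additive_def)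
  note ad = additive_dH[OF assms]
  have zero: "(\<lambda>u. 0) \<in> B1 A M T"
    unfolding B1_def using additive.zero[OF tw] additive.zero[OF ad] by fastforce
  have diff: "(\<lambda>u. p u - q u) \<in> B1 A M T" if p: "p \<in> B1 A M T" and q: "q \<in> B1 A M T" for p q
  proof -
    obtain a b where ab: "p = dH A M T a" "twist A a = a" "q = dH A M T b" "twist A b = b"
      using p q by (auto simp: B1_def)
    have "(\<lambda>u. p u - q u) = dH A M T (a - b)"
      by (rule ext) (simp add: ab additive.diff[OF ad])
    then show ?thesis
      unfolding B1_def using ab additive.diff[OF tw, of a b] by auto
  qed
  show ?thesis
  proof (rule equivI)
    show "cohomologous A M T \<subseteq> Z1 A M T \<times> Z1 A M T"
      by (auto simp: cohomologous_def)
    show "refl_on (Z1 A M T) (cohomologous A M T)"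
      using zero by (auto simp: cohomologous_def refl_on_def)
    show "sym (cohomologous A M T)"
      using diff[OF zero] by (fastforce simp: cohomologous_def sym_def)
    show "trans (cohomologous A M T)"
    proof (rule transI)
      fix p q r
      assume pq: "(p, q) \<in> cohomologous A M T" and qr: "(q, r) \<in> cohomologous A M T"
      have "(\<lambda>u. (p u - q u) - (0 - (q u - r u))) \<in> B1 A M T"
        using pq qr
        by (intro diff[of "\<lambda>u. p u - q u" "\<lambda>u. 0 - (q u - r u)"]
            diff[of "\<lambda>u. 0" "\<lambda>u. q u - r u"] zero) (auto simp: cohomologous_def)
      then show "(p, r) \<in> cohomologous A M T"
        using pq qr by (auto simp: cohomologous_def)
    qed
  qed
qed

end

theory Submission
  imports Defs
begin

text \<open>
  Both claims are read off from the coefficient of \<open>t\<close>, on constant series. For one deformation,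
  the O-operator identity of \<open>T\<^sub>t\<close> at \<open>u, v \<in> M\<close> has as its coefficient of \<open>t\<close> the cocycle identity
  of \<open>T\<^sub>1\<close>; this is the lemma \<open>infinitesimal_cocycle\<close>. For two equivalent deformations, the
  intertwining relation \<open>f\<^sub>t T\<^sub>t = T'\<^sub>t g\<^sub>t\<close> at \<open>u\<close> has the coefficient
  \<open>T\<^sub>1 u + (x \<cdot> T u - T u \<cdot> x) = T'\<^sub>1 u + T (l(x,u) - r(u,x))\<close> of \<open>t\<close>, where \<open>x\<close> is the
  \<open>\<alpha>\<close>-invariant element that determines the first-order terms of \<open>f\<^sub>t\<close> and \<open>g\<^sub>t\<close>. It rearranges
  to \<open>T\<^sub>1 - T'\<^sub>1 = d\<^sub>H(x)\<close>, an element of \<open>B\<^sup>1\<close>; this is the lemma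
  \<open>infinitesimal_diff_coboundary\<close>.
\<close>

lemma ps_series_nth_1: "fps_nth (ps_series F X) 1 = F 0 (fps_nth X 1) + F 1 (fps_nth X 0)"
  by (simp add: ps_series_def)

lemma ps_bilinear_nth_1:
  "fps_nth (ps_bilinear B X Y) 1 =
     B (fps_nth X 0) (fps_nth Y 1) + B (fps_nth X 1) (fps_nth Y 0)"
  by (simp add: ps_bilinear_def)

text \<open>
  The vanishing at \<open>0\<close> is a hypothesis because the coefficients of a constant series above degree
  \<open>0\<close> still enter the Cauchy product; maps that preserve \<open>0\<close> make them disappear.
\<close>

lemma ps_series_const_nth:
  assumes "\<And>i. F i 0 = 0"
  shows "fps_nth (ps_series F (fps_const u)) n = F n u"
proof -
  have "(\<Sum>i=0..n. F i (if n - i = 0 then u else 0)) = (\<Sum>i\<in>{n}. F i u)"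
    by (rule sum.mono_neutral_cong_right) (auto simp: assms)
  then show ?thesis
    by (simp add: ps_series_def)
qed

lemma ps_bilinear_const_left_nth:
  assumes "\<And>y. B 0 y = 0"
  shows "fps_nth (ps_bilinear B (fps_const x) Y) n = B x (fps_nth Y n)"
proof -
  have "(\<Sum>i=0..n. B (if i = 0 then x else 0) (fps_nth Y (n - i))) =
      (\<Sum>i\<in>{0}. B x (fps_nth Y (n - i)))"
    by (rule sum.mono_neutral_cong_right) (auto simp: assms)
  then show ?thesis
    by (simp add: ps_bilinear_def)
qed

lemma ps_bilinear_const_right_nth:
  assumes "\<And>x. B x 0 = 0"
  shows "fps_nth (ps_bilinear B X (fps_const y)) n = B (fps_nth X n) y"
  by (subst ps_bilinear_flip) (simp add: ps_bilinear_const_left_nth assms)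

lemma C1_zero: "f \<in> C1 A M \<Longrightarrow> f 0 = 0"
  by (auto simp: C1_def dest: module_hom.zero)

lemma bilinear_map_zero:
  assumes "bilinear_map s1 s2 s3 B"
  shows "B 0 y = 0" "B x 0 = 0"
  using bilinear_map_additive[OF assms] by (auto dest: additive.zero)

lemma infinitesimal_cocycle:
  assumes M: "hom_bimodule A M" and D: "formal_deformation A M T Tt"
  shows "infinitesimal Tt \<in> Z1 A M T"
proof -
  have T0: "Tt 0 = T" and C: "\<And>i. Tt i \<in> C1 A M"
    and O: "O_operator (ps_alg A) (ps_bimod M) (ps_series Tt)"
    using D by (auto simp: formal_deformation_def)
  have l: "bilinear_map (smult A) (msmult M) (msmult M) (lact M)"
    and r: "bilinear_map (msmult M) (smult A) (msmult M) (ract M)"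
    using M by (auto simp: hom_bimodule_def)
  note coeff = ps_series_const_nth[of Tt, OF C1_zero[OF C]]
    ps_bilinear_const_left_nth[of "ract M", OF bilinear_map_zero(1)[OF r]]
    ps_bilinear_const_right_nth[of "lact M", OF bilinear_map_zero(2)[OF l]]
  have "mul A (T u) (Tt 1 v) + mul A (Tt 1 u) (T v)
      = T (ract M u (Tt 1 v) + lact M (Tt 1 u) v) + Tt 1 (ract M u (T v) + lact M (T u) v)"
    for u v
  proof -
    let ?u = "fps_const u" and ?v = "fps_const v"
    have "ps_bilinear (mul A) (ps_series Tt ?u) (ps_series Tt ?v) =
        ps_series Tt (ps_bilinear (lact M) (ps_series Tt ?u) ?v
          + ps_bilinear (ract M) ?u (ps_series Tt ?v))"
      using O by (auto simp: O_operator_def ps_alg_def ps_bimod_def)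
    \<comment> \<open>Only the outer series acts on a sum, whose coefficients \<open>0\<close> and \<open>1\<close> both matter; the inner
      ones act on constants, where coefficient \<open>n\<close> is simply \<open>T\<^sub>n\<close>.\<close>
    from arg_cong[OF this, of "\<lambda>s. fps_nth s 1"] show ?thesis
      by (simp only: ps_series_nth_1[of Tt "X + Y" for X Y] ps_bilinear_nth_1[of "mul A"]
          fps_add_nth coeff T0 add.commute)
  qed
  then show ?thesis
    using C[of 1] by (simp add: Z1_def infinitesimal_def)
qed

lemma infinitesimal_diff_coboundary:
  assumes T: "O_operator A M T"
    and D: "formal_deformation A M T Tt" and D': "formal_deformation A M T Tt'"
    and E: "equivalent_deformations A M Tt Tt'"
  shows "(\<lambda>u. infinitesimal Tt u - infinitesimal Tt' u) \<in> B1 A M T"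
proof -
  have T0: "Tt 0 = T" "Tt' 0 = T" and C: "\<And>i. Tt i \<in> C1 A M"
    using D D' by (auto simp: formal_deformation_def)
  obtain x f g where x: "twist A x = x"
    and f: "f 0 = id" "f 1 = (\<lambda>y. mul A x y - mul A y x)"
    and g: "g 0 = id" "g 1 = (\<lambda>u. lact M x u - ract M u x)"
    and fg: "ps_series f \<circ> ps_series Tt = ps_series Tt' \<circ> ps_series g"
    using E unfolding equivalent_deformations_def by blast
  have Tdiff: "T (p - q) = T p - T q" for p q
    using T by (auto simp: O_operator_def dest: module_hom.diff)
  have "Tt 1 u - Tt' 1 u = dH A M T x u" for u
  proof -
    have g_const: "fps_nth (ps_series g (fps_const u)) 0 = u"
      "fps_nth (ps_series g (fps_const u)) 1 = lact M x u - ract M u x"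
      using g by (simp_all add: ps_series_def)
    have "fps_nth (ps_series f (ps_series Tt (fps_const u))) 1 =
        fps_nth (ps_series Tt' (ps_series g (fps_const u))) 1"
      using fun_cong[OF fg, of "fps_const u"] by simp
    then have "Tt 1 u + (mul A x (T u) - mul A (T u) x)
        = T (lact M x u - ract M u x) + Tt' 1 u"
      by (simp only: ps_series_nth_1[of f] ps_series_nth_1[of Tt'] g_const
          ps_series_const_nth[of Tt, OF C1_zero[OF C]] f T0 id_apply)
    then show ?thesis
      by (simp add: dH_def Tdiff algebra_simps)
  qed
  then show ?thesis
    using x by (auto simp: B1_def infinitesimal_def)
qed

theorem proposition4p17:
  fixes A :: "('k::field, 'a::ab_group_add) hom_alg"
    and M :: "('k, 'a, 'm::ab_group_add) hom_bimod"
    and T :: "'m \<Rightarrow> 'a"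
    and Tt Tt' :: "nat \<Rightarrow> 'm \<Rightarrow> 'a"
  assumes "hom_assoc_algebra A"
    and "hom_bimodule A M"
    and "O_operator A M T"
    and "formal_deformation A M T Tt"
    and "formal_deformation A M T Tt'"
    and "equivalent_deformations A M Tt Tt'"
  shows "infinitesimal Tt \<in> Z1 A M T \<and> infinitesimal Tt' \<in> Z1 A M T \<and>
         cohomology_class A M T (infinitesimal Tt) \<in> H1 A M T \<and>
         cohomology_class A M T (infinitesimal Tt) = cohomology_class A M T (infinitesimal Tt')"
proof -
  have Z: "infinitesimal Tt \<in> Z1 A M T" "infinitesimal Tt' \<in> Z1 A M T"
    using assms by (auto intro: infinitesimal_cocycle)
  have "(infinitesimal Tt, infinitesimal Tt') \<in> cohomologous A M T"
    using Z infinitesimal_diff_coboundary[OF assms(3-6)] by (simp add: cohomologous_def)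
  then have "cohomology_class A M T (infinitesimal Tt) = cohomology_class A M T (infinitesimal Tt')"
    unfolding cohomology_class_def
    by (rule equiv_class_eq[OF equiv_cohomologous[OF assms(1-3)]])
  then show ?thesis
    using Z by (simp add: H1_def cohomology_class_def quotientI)
qed

end
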